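(* Let $(S,\ge)$ be a finite partially ordered set. Suppose there exist two involutions $\iota_1,\iota_2$ on $S$ (maps $S\to S$ with $\iota_k\circ\iota_k=\mathrm{id}_S$, not assumed to be order-preserving or order-reversing) such that $\iota_1(s)\ge\iota_2(s)$ for all $s\in S$. Then $\iota_1=\iota_2$. *)

theory Defs
  imports Main "HOL-Library.FuncSet"
begin

(* A map S -> S is represented by a total function on the ambient type; its values outside S
   are irrelevant, so equality of such maps is equality on S. *)
definition involution_on :: "'a set \<Rightarrow> ('a \<Rightarrow> 'a) \<Rightarrow> bool" where
  "involution_on S f \<longleftrightarrow> f \<in> S \<rightarrow> S \<and> (\<forall>s\<in>S. f (f s) = s)"

end

theory Submission
  imports Defs
begin

text \<open>The number of elements of \<open>S\<close> below \<open>s\<close> is a strictly monotone weight, and its total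
  over \<open>S\<close> is unchanged by reindexing along either involution. So the weights of \<open>\<iota>\<^sub>2 s\<close> and
  \<open>\<iota>\<^sub>1 s\<close>, which are comparable for each \<open>s\<close>, agree for each \<open>s\<close>.\<close>

lemma involution_on_bij_betw:
  assumes "involution_on S f"
  shows "bij_betw f S S"
  using assms unfolding involution_on_def
  by (intro bij_betw_byWitness[where f' = f]) auto

lemma card_down_set_mono:
  assumes "finite S" and "trans r" and "(x, y) \<in> r"
  shows "card {t \<in> S. (t, x) \<in> r} \<le> card {t \<in> S. (t, y) \<in> r}"
  using assms by (intro card_mono) (auto dest: transD)

text \<open>Strictness of the weight: by transitivity the down-set of \<open>x\<close> lies inside
  that of \<open>y\<close>, so equal finite cardinalities force the two sets to coincide. Since
  \<open>y\<close> belongs to its own down-set, it then lies below \<open>x\<close>, and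
  antisymmetry applies.\<close>

lemma card_down_set_eqD:
  assumes "finite S" and po: "partial_order_on S r"
    and "y \<in> S" and "(x, y) \<in> r"
    and "card {t \<in> S. (t, x) \<in> r} = card {t \<in> S. (t, y) \<in> r}"
  shows "x = y"
proof -
  have r: "refl_on S r" "trans r" "antisym r"
    using po by (auto simp: partial_order_on_def preorder_on_def)
  have "{t \<in> S. (t, x) \<in> r} \<subseteq> {t \<in> S. (t, y) \<in> r}"
    using assms(4) r(2) by (auto dest: transD)
  with assms(1,5) have "{t \<in> S. (t, x) \<in> r} = {t \<in> S. (t, y) \<in> r}"
    by (intro card_subset_eq) auto
  moreover have "(y, y) \<in> r"
    using r(1) assms(3) by (rule refl_onD)
  ultimately have "(y, x) \<in> r"
    using assms(3) by blast
  with assms(4) r(3) show ?thesis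
    by (auto dest: antisymD)
qed

theorem lemma1p2:
  fixes S :: "'a set" and r :: "'a rel" and \<iota>\<^sub>1 \<iota>\<^sub>2 :: "'a \<Rightarrow> 'a"
  assumes "finite S"
    and "partial_order_on S r"
    and "involution_on S \<iota>\<^sub>1"
    and "involution_on S \<iota>\<^sub>2"
    and "\<And>s. s \<in> S \<Longrightarrow> (\<iota>\<^sub>2 s, \<iota>\<^sub>1 s) \<in> r"
  shows "\<forall>s\<in>S. \<iota>\<^sub>1 s = \<iota>\<^sub>2 s"
proof
  fix s assume s: "s \<in> S"
  define w where "w x = card {t \<in> S. (t, x) \<in> r}" for x
  have tr: "trans r"
    using assms(2) by (auto simp: partial_order_on_def preorder_on_def)
  have "(\<Sum>s\<in>S. w (\<iota>\<^sub>2 s)) = (\<Sum>s\<in>S. w (\<iota>\<^sub>1 s))"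
    using assms(3,4)
    by (simp add: sum.reindex_bij_betw[OF involution_on_bij_betw])
  moreover have "w (\<iota>\<^sub>2 t) \<le> w (\<iota>\<^sub>1 t)" if "t \<in> S" for t
    unfolding w_def using assms(1) tr assms(5)[OF that] by (rule card_down_set_mono)
  \<comment> \<open>Termwise comparable finite sums with equal totals cannot differ in any single
    term.\<close>
  ultimately have "w (\<iota>\<^sub>2 s) = w (\<iota>\<^sub>1 s)"
    using s assms(1) by (rule sum_mono_inv)
  \<comment> \<open>Reflexivity of \<open>r\<close> is available only on \<open>S\<close>, so the
    larger element must be placed there before \<open>card_down_set_eqD\<close> applies.\<close>
  moreover have "\<iota>\<^sub>1 s \<in> S"
    using assms(3) s by (auto simp: involution_on_def)
  ultimately have "\<iota>\<^sub>2 s = \<iota>\<^sub>1 s"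
    using card_down_set_eqD[OF assms(1,2)] assms(5)[OF s] by (simp add: w_def)
  then show "\<iota>\<^sub>1 s = \<iota>\<^sub>2 s" ..
qed

end
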